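(* Consider a two-dimensional periodic spQUBO with spatial shape $\boldsymbol{L}=(L_1,L_2)$, spatial coupling function $f$, coefficients $c_i$ and grid points $\boldsymbol{d}_i$ ($i=1,\dots,N$), and let $x_1,\dots,x_N\in\{0,1\}$. Let $$a_i=\sum_{j=1}^N c_ic_jf(\boldsymbol{d}_i-\boldsymbol{d}_j)x_j\qquad(i=1,\dots,N)$$ be the elements of the matrix-vector product. Define $\xi\colon\mathbb{Z}^2\to\mathbb{R}$ to be the function with period $\boldsymbol{L}$ given for $\boldsymbol{x}\in[\boldsymbol{L})$ by $\xi(\boldsymbol{x})=c_ix_i$ if $\boldsymbol{x}=\boldsymbol{d}_i$ for some $i$, and $\xi(\boldsymbol{x})=0$ otherwise. Then, for every $i$, $$a_i=c_i\,\mathcal{F}^{-1}\big[\mathcal{F}[\xi]\odot\mathcal{F}[f]\big](\boldsymbol{d}_i),$$ where $\odot$ denotes the element-wise (pointwise) product and $\mathcal{F}$, $\mathcal{F}^{-1}$ are the discrete Fourier transform and its inverse.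
   Context: For $\boldsymbol{L}\in\mathbb{N}^2$ (positive entries), $[\boldsymbol{L})=\{\boldsymbol{d}\in\mathbb{Z}^2\mid \boldsymbol{0}\le\boldsymbol{d}<\boldsymbol{L}\}$ with element-wise inequalities. A function $\phi$ on $\mathbb{Z}^2$ has period $\boldsymbol{L}$ if $\phi(\boldsymbol{d})=\phi(\boldsymbol{d}+\boldsymbol{k}\odot\boldsymbol{L})$ for all $\boldsymbol{d},\boldsymbol{k}\in\mathbb{Z}^2$. A two-dimensional periodic spQUBO with spatial shape $\boldsymbol{L}$ is given by a function $f\colon\mathbb{Z}^2\to\mathbb{R}$ (the spatial coupling function) that is symmetric, $f(\boldsymbol{d})=f(-\boldsymbol{d})$, and has period $\boldsymbol{L}$, together with coefficients $c_i\in\mathbb{R}$, biases $b_i\in\mathbb{R}$ (not used here) and pairwise distinct grid points $\boldsymbol{d}_i\in[\boldsymbol{L})$ for $i=1,\dots,N$; it is the problem of maximizing $\frac12\sum_{i,j}c_ic_jf(\boldsymbol{d}_i-\boldsymbol{d}_j)x_ix_j+\sum_i b_ix_i$ over $x_i\in\{0,1\}$. For $\phi$ on $\mathbb{Z}^2$ with period $\boldsymbol{L}$ and $V=L_1L_2$: $\mathcal{F}[\phi](\boldsymbol{k})=\sum_{\boldsymbol{x}\in[\boldsymbol{L})}\phi(\boldsymbol{x})\exp\left(-2\pi\mathrm{i}\sum_{d=1}^2 k_dx_d/L_d\right)$ and $\mathcal{F}^{-1}[\phi](\boldsymbol{k})=\frac1V\sum_{\boldsymbol{x}\in[\boldsymbol{L})}\phi(\boldsymbol{x})\exp\left(2\pi\mathrm{i}\sum_{d=1}^2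 k_dx_d/L_d\right)$. *)

theory Defs
  imports "HOL-Analysis.Analysis"
begin

definition box2 :: "nat \<times> nat \<Rightarrow> (int \<times> int) set" where
  "box2 L = {0..<int (fst L)} \<times> {0..<int (snd L)}"

definition has_period2 :: "nat \<times> nat \<Rightarrow> (int \<times> int \<Rightarrow> 'a) \<Rightarrow> bool" where
  "has_period2 L \<phi> \<longleftrightarrow>
     (\<forall>d k. \<phi> d = \<phi> (d + (fst k * int (fst L), snd k * int (snd L))))"

definition periodic_ext2 :: "nat \<times> nat \<Rightarrow> (int \<times> int \<Rightarrow> 'a) \<Rightarrow> int \<times> int \<Rightarrow> 'a" where
  "periodic_ext2 L g d = g (fst d mod int (fst L), snd d mod int (snd L))"

definition dft2 :: "nat \<times> nat \<Rightarrow> (int \<times> int \<Rightarrow> complex) \<Rightarrow> int \<times> int \<Rightarrow> complex" where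
  "dft2 L \<phi> k = (\<Sum>x\<in>box2 L. \<phi> x *
     exp (- 2 * complex_of_real pi * \<i> *
       (of_int (fst k) * of_int (fst x) / of_nat (fst L) +
        of_int (snd k) * of_int (snd x) / of_nat (snd L))))"

definition idft2 :: "nat \<times> nat \<Rightarrow> (int \<times> int \<Rightarrow> complex) \<Rightarrow> int \<times> int \<Rightarrow> complex" where
  "idft2 L \<phi> k = 1 / of_nat (fst L * snd L) * (\<Sum>x\<in>box2 L. \<phi> x *
     exp (2 * complex_of_real pi * \<i> *
       (of_int (fst k) * of_int (fst x) / of_nat (fst L) +
        of_int (snd k) * of_int (snd x) / of_nat (snd L))))"

text \<open>The data of a two-dimensional spQUBO. Only the values of the coefficients, biases and
  grid points at the indices \<open>1..num_vars P\<close> matter.\<close>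

record spqubo2 =
  shape :: "nat \<times> nat"
  coupling :: "int \<times> int \<Rightarrow> real"
  num_vars :: nat
  coefficient :: "nat \<Rightarrow> real"
  bias :: "nat \<Rightarrow> real"
  grid :: "nat \<Rightarrow> int \<times> int"

definition periodic_spqubo2 :: "spqubo2 \<Rightarrow> bool" where
  "periodic_spqubo2 P \<longleftrightarrow>
     0 < fst (shape P) \<and> 0 < snd (shape P) \<and>
     (\<forall>d. coupling P d = coupling P (- d)) \<and>
     has_period2 (shape P) (coupling P) \<and>
     (\<forall>i\<in>{1..num_vars P}. grid P i \<in> box2 (shape P)) \<and>
     inj_on (grid P) {1..num_vars P}"

definition spqubo2_matvec :: "spqubo2 \<Rightarrow> (nat \<Rightarrow> real) \<Rightarrow> nat \<Rightarrow> real" where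
  "spqubo2_matvec P x i =
     (\<Sum>j=1..num_vars P. coefficient P i * coefficient P j * coupling P (grid P i - grid P j) * x j)"

text \<open>The objective function, to be maximized over \<open>x i \<in> {0, 1}\<close>.\<close>

definition spqubo2_objective :: "spqubo2 \<Rightarrow> (nat \<Rightarrow> real) \<Rightarrow> real" where
  "spqubo2_objective P x =
     1 / 2 * (\<Sum>i=1..num_vars P. \<Sum>j=1..num_vars P.
        coefficient P i * coefficient P j * coupling P (grid P i - grid P j) * x i * x j) +
     (\<Sum>i=1..num_vars P. bias P i * x i)"

text \<open>The index selected by \<open>THE\<close> is unique because the grid points are pairwise distinct;
  the lemmas below confirm the resulting values on \<open>box2 (shape P)\<close>.\<close>

definition spqubo2_xi :: "spqubo2 \<Rightarrow> (nat \<Rightarrow> real) \<Rightarrow> int \<times> int \<Rightarrow> real" where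
  "spqubo2_xi P x = periodic_ext2 (shape P)
     (\<lambda>y. if \<exists>i\<in>{1..num_vars P}. y = grid P i
          then (let i = (THE i. i \<in> {1..num_vars P} \<and> y = grid P i) in coefficient P i * x i)
          else 0)"

lemma has_period2_spqubo2_xi: "has_period2 (shape P) (spqubo2_xi P x)"
  unfolding has_period2_def spqubo2_xi_def periodic_ext2_def by simp

lemma periodic_ext2_box2: "y \<in> box2 L \<Longrightarrow> periodic_ext2 L g y = g y"
  by (auto simp: box2_def periodic_ext2_def)

lemma spqubo2_xi_grid:
  assumes "periodic_spqubo2 P" and "i \<in> {1..num_vars P}"
  shows "spqubo2_xi P x (grid P i) = coefficient P i * x i"
proof -
  have inj: "inj_on (grid P) {1..num_vars P}" and box: "grid P i \<in> box2 (shape P)"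
    using assms unfolding periodic_spqubo2_def by blast+
  have "(THE j. j \<in> {1..num_vars P} \<and> grid P i = grid P j) = i"
    using assms(2) inj_onD[OF inj] by (intro the_equality) blast+
  then show ?thesis
    using assms(2) unfolding spqubo2_xi_def periodic_ext2_box2[OF box] Let_def by auto
qed

lemma spqubo2_xi_not_grid:
  assumes "y \<in> box2 (shape P)" and "y \<notin> grid P ` {1..num_vars P}"
  shows "spqubo2_xi P x y = 0"
  using assms unfolding spqubo2_xi_def by (auto simp: periodic_ext2_box2)

end

theory Submission
  imports Defs
begin

text \<open>Orthogonality of the characters of \<open>\<int>/L\<^sub>1 \<times> \<int>/L\<^sub>2\<close> gives the convolution theorem. The cyclic
  convolution of \<open>\<xi>\<close> and \<open>f\<close> at \<open>d\<^sub>i\<close> is a sum over the box, and since \<open>\<xi>\<close> vanishes off the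
  pairwise distinct grid points, it collapses to the sum over \<open>j\<close> defining the matrix-vector product.\<close>

definition root1 :: "nat \<Rightarrow> int \<Rightarrow> complex" where
  "root1 n m = exp (2 * complex_of_real pi * \<i> * (of_int m / of_nat n))"

lemma root1_add: "root1 n (a + b) = root1 n a * root1 n b"
  by (simp add: root1_def exp_add[symmetric] add_divide_distrib distrib_left)

lemma root1_mult_of_nat: "root1 n (int k * m) = root1 n m ^ k"
  by (simp add: root1_def exp_of_nat_mult[symmetric] mult_ac)

text \<open>An exponential is 1 exactly at the integer multiples of 2 pi i; cancelling 2 pi and
  clearing \<open>n\<close> leaves \<open>m = n * q\<close>.\<close>

lemma root1_eq_1_iff:
  assumes "n > 0"
  shows "root1 n m = 1 \<longleftrightarrow> int n dvd m"
proof -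
  have "root1 n m = 1 \<longleftrightarrow> (\<exists>q::int. 2 * pi * (of_int m / of_nat n) = of_int (2 * q) * pi)"
    by (simp add: root1_def exp_eq_1 Re_divide_of_nat Im_divide_of_nat)
  also have "\<dots> \<longleftrightarrow> (\<exists>q::int. real_of_int m = real_of_int (int n * q))"
    using assms by (intro ex_cong1) (auto simp: field_simps)
  also have "\<dots> \<longleftrightarrow> int n dvd m"
    by (simp only: of_int_eq_iff dvd_def)
  finally show ?thesis .
qed

text \<open>This is a geometric sum whose ratio \<open>root1 n m\<close> is an \<open>n\<close>-th
  root of unity: it has \<open>n\<close> terms equal to 1 if the ratio is 1, and otherwise the
  numerator of the closed form vanishes.\<close>

lemma sum_root1:
  assumes "n > 0"
  shows "(\<Sum>k\<in>{0..<int n}. root1 n (k * m)) = (if int n dvd m then of_nat n else 0)"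
proof -
  have "(\<Sum>k\<in>{0..<int n}. root1 n (k * m)) = (\<Sum>k<n. root1 n m ^ k)"
    by (rule sum.reindex_bij_witness[of _ int nat]) (auto simp: root1_mult_of_nat[symmetric])
  moreover have "root1 n m ^ n = 1"
    using root1_mult_of_nat[of n n m] root1_eq_1_iff[OF assms, of "int n * m"] by simp
  ultimately show ?thesis
    using root1_eq_1_iff[OF assms, of m] geometric_sum[of "root1 n m" n] by auto
qed

definition character2 :: "nat \<times> nat \<Rightarrow> int \<times> int \<Rightarrow> int \<times> int \<Rightarrow> complex" where
  "character2 L k x = root1 (fst L) (fst k * fst x) * root1 (snd L) (snd k * snd x)"

lemma character2_add: "character2 L k (x + y) = character2 L k x * character2 L k y"
  by (simp add: character2_def distrib_left root1_add)

text \<open>The minus sign goes into the argument, so that additivity alone merges the forward and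
  inverse kernels.\<close>

lemma dft2_character2: "dft2 L \<phi> k = (\<Sum>x\<in>box2 L. \<phi> x * character2 L k (- x))"
  by (auto simp: dft2_def character2_def root1_def exp_add[symmetric] algebra_simps
      intro!: sum.cong)

lemma idft2_character2:
  "idft2 L \<phi> k = 1 / of_nat (fst L * snd L) * (\<Sum>x\<in>box2 L. \<phi> x * character2 L x k)"
  by (simp add: idft2_def character2_def root1_def exp_add[symmetric] distrib_left mult.commute)

lemma sum_character2:
  assumes "fst L > 0" "snd L > 0"
  shows "(\<Sum>k\<in>box2 L. character2 L k x) =
    (if int (fst L) dvd fst x \<and> int (snd L) dvd snd x then of_nat (fst L * snd L) else 0)"
proof -
  have "(\<Sum>k\<in>box2 L. character2 L k x) =
    (\<Sum>k\<in>{0..<int (fst L)}. root1 (fst L) (k * fst x)) *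
    (\<Sum>k\<in>{0..<int (snd L)}. root1 (snd L) (k * snd x))"
    by (simp add: box2_def character2_def sum_product sum.cartesian_product case_prod_beta)
  then show ?thesis
    by (simp add: sum_root1 assms)
qed

lemma has_period2_mod:
  assumes "has_period2 L \<phi>"
  shows "\<phi> (fst d mod int (fst L), snd d mod int (snd L)) = \<phi> d"
proof -
  have "\<phi> (fst d mod int (fst L), snd d mod int (snd L)) =
    \<phi> ((fst d mod int (fst L), snd d mod int (snd L)) +
      (fst d div int (fst L) * int (fst L), snd d div int (snd L) * int (snd L)))"
    using assms unfolding has_period2_def by (metis fst_conv snd_conv)
  then show ?thesis by simp
qed

text \<open>The box meets each residue class exactly once, so the condition selects a single
  \<open>z\<close>, and there \<open>\<psi> z = \<psi> d\<close> by periodicity. The condition has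
  the shape that \<open>sum_character2\<close> produces.\<close>

lemma sum_box2_congruent:
  fixes \<psi> :: "int \<times> int \<Rightarrow> complex"
  assumes L: "fst L > 0" "snd L > 0" and "has_period2 L \<psi>"
  shows "(\<Sum>z\<in>box2 L. \<psi> z *
    (if int (fst L) dvd fst (d - z) \<and> int (snd L) dvd snd (d - z) then c else 0)) = \<psi> d * c"
proof -
  define w where "w = (fst d mod int (fst L), snd d mod int (snd L))"
  have w: "w \<in> box2 L"
    using L by (auto simp: w_def box2_def)
  have iff: "int (fst L) dvd fst (d - z) \<and> int (snd L) dvd snd (d - z) \<longleftrightarrow> z = w"
    if "z \<in> box2 L" for z
    using that by (auto simp: w_def box2_def mod_eq_dvd_iff[symmetric])
  have "(\<Sum>z\<in>box2 L. \<psi> z *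
      (if int (fst L) dvd fst (d - z) \<and> int (snd L) dvd snd (d - z) then c else 0)) =
    (\<Sum>z\<in>box2 L. if z = w then \<psi> w * c else 0)"
    \<comment> \<open>Keeping \<open>fst (d - z)\<close> unsplit lets \<open>iff\<close>
      match.\<close>
    by (rule sum.cong) (simp_all add: iff del: fst_diff snd_diff)
  also have "\<dots> = \<psi> w * c"
    using w by (simp add: box2_def)
  finally show ?thesis
    using has_period2_mod[OF assms(3), of d] by (simp add: w_def)
qed

text \<open>Since \<open>\<psi>\<close> is periodic, \<open>d - y\<close> may leave the box, and the
  cyclic convolution needs no explicit reduction.\<close>

theorem convolution2:
  assumes L: "fst L > 0" "snd L > 0" and per: "has_period2 L \<psi>"
  shows "idft2 L (\<lambda>k. dft2 L \<phi> k * dft2 L \<psi> k) d = (\<Sum>y\<in>box2 L. \<phi> y * \<psi> (d - y))"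
proof -
  let ?V = "of_nat (fst L * snd L) :: complex"
  have split: "character2 L k (d - y - z) =
    character2 L k d * (character2 L k (- y) * character2 L k (- z))" for k y z
    using character2_add[of L k d "- y + - z"] character2_add[of L k "- y" "- z"]
    by (simp add: algebra_simps)
  have "(\<Sum>k\<in>box2 L. dft2 L \<phi> k * dft2 L \<psi> k * character2 L k d) =
    (\<Sum>k\<in>box2 L. \<Sum>y\<in>box2 L. \<Sum>z\<in>box2 L. \<phi> y * (\<psi> z * character2 L k (d - y - z)))"
    unfolding dft2_character2 sum_product
    unfolding sum_distrib_right split by (simp only: ac_simps)
  \<comment> \<open>Two interchanges move the frequency \<open>k\<close> innermost, where
    orthogonality applies.\<close>
  also have "\<dots> = (\<Sum>y\<in>box2 L. \<Sum>k\<in>box2 L. \<Sum>z\<in>box2 L. \<phi> y * (\<psi> z * character2 L k (d - y - z)))"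
    by (rule sum.swap)
  also have "\<dots> = (\<Sum>y\<in>box2 L. \<Sum>z\<in>box2 L. \<Sum>k\<in>box2 L. \<phi> y * (\<psi> z * character2 L k (d - y - z)))"
    by (rule sum.cong[OF refl], rule sum.swap)
  also have "\<dots> = (\<Sum>y\<in>box2 L. \<phi> y * (\<Sum>z\<in>box2 L. \<psi> z * (\<Sum>k\<in>box2 L. character2 L k (d - y - z))))"
    by (simp only: sum_distrib_left)
  \<comment> \<open>Orthogonality keeps only the \<open>z\<close> congruent to \<open>d - y\<close>;
    the factor \<open>?V\<close> later cancels the normalization of the inverse transform.\<close>
  also have "\<dots> = (\<Sum>y\<in>box2 L. \<phi> y * (\<psi> (d - y) * ?V))"
    by (simp only: sum_character2[OF L] sum_box2_congruent[OF L per])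
  finally show ?thesis
    using L by (simp add: idft2_character2 sum_distrib_left)
qed

theorem theorem4:
  fixes P :: spqubo2 and x :: "nat \<Rightarrow> real" and i :: nat
  assumes "periodic_spqubo2 P"
    and "\<And>j. j \<in> {1..num_vars P} \<Longrightarrow> x j \<in> {0, 1}"
    and "i \<in> {1..num_vars P}"
  shows "complex_of_real (spqubo2_matvec P x i) =
    complex_of_real (coefficient P i) *
    idft2 (shape P)
      (\<lambda>k. dft2 (shape P) (\<lambda>y. complex_of_real (spqubo2_xi P x y)) k *
           dft2 (shape P) (\<lambda>y. complex_of_real (coupling P y)) k)
      (grid P i)"
proof -
  let ?I = "{1..num_vars P}"
  have L: "fst (shape P) > 0" "snd (shape P) > 0"
    and per: "has_period2 (shape P) (\<lambda>y. complex_of_real (coupling P y))"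
    and box: "grid P ` ?I \<subseteq> box2 (shape P)" and inj: "inj_on (grid P) ?I"
    using assms(1) by (auto simp: periodic_spqubo2_def has_period2_def)
  have "(\<Sum>y\<in>box2 (shape P). spqubo2_xi P x y * coupling P (grid P i - y)) =
    (\<Sum>y\<in>grid P ` ?I. spqubo2_xi P x y * coupling P (grid P i - y))"
    using box by (intro sum.mono_neutral_right) (auto simp: box2_def spqubo2_xi_not_grid)
  \<comment> \<open>Distinctness of the grid points lets the sum over the image be reindexed by
    \<open>j\<close> without collisions.\<close>
  also have "\<dots> = (\<Sum>j\<in>?I. coefficient P j * x j * coupling P (grid P i - grid P j))"
    unfolding sum.reindex[OF inj] o_def
    by (intro sum.cong refl) (simp only: spqubo2_xi_grid[OF assms(1)])
  finally have "spqubo2_matvec P x i = coefficient P i *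
    (\<Sum>y\<in>box2 (shape P). spqubo2_xi P x y * coupling P (grid P i - y))"
    by (simp add: spqubo2_matvec_def sum_distrib_left mult_ac)
  \<comment> \<open>The embedding of the reals commutes with sums and products, so the real identity
    carries over to the complex transforms.\<close>
  then show ?thesis
    by (simp add: convolution2[OF L per])
qed

end
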